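(* Let $X$ be a real Banach space and $F$ a Banach lattice. Let $(T_n)$ be a sequence of Dunford--Pettis L-weakly compact operators from $X$ to $F$ that converges in operator norm to a bounded linear operator $T:X\to F$. Then $T$ is Dunford--Pettis L-weakly compact.
   Context: For a subset $A$ of a Banach lattice, $\mathrm{sol}(A)=\bigcup_{a\in A}[-|a|,|a|]$. A subset $A$ of a Banach lattice is an Lwc set (L-weakly compact set) if every disjoint sequence in $\mathrm{sol}(A)$ converges to $0$ in norm. A bounded subset $A$ of a Banach space $X$ is a Dunford--Pettis set if every weakly null sequence $(f_n)$ in the dual $X'$ satisfies $\sup_{a\in A}|f_n(a)|\to 0$. A bounded linear operator $T:X\to F$ is Dunford--Pettis L-weakly compact (DP-Lwc) if it maps Dunford--Pettis subsets of $X$ to Lwc subsets of $F$. *)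

theory Defs
  imports "HOL-Analysis.Analysis" "HOL-Library.Lattice_Algebras"
begin

class banach_lattice = banach + ordered_real_vector + lattice_ab_group_add_abs +
  assumes lattice_norm_mono: "\<bar>x\<bar> \<le> \<bar>y\<bar> \<Longrightarrow> norm x \<le> norm y"

instance real :: banach_lattice
  by standard simp

definition solid_hull :: "'b::banach_lattice set \<Rightarrow> 'b set" where
  "solid_hull A = (\<Union>a\<in>A. {- \<bar>a\<bar>..\<bar>a\<bar>})"

definition disjoint_sequence :: "(nat \<Rightarrow> 'b::banach_lattice) \<Rightarrow> bool" where
  "disjoint_sequence x \<longleftrightarrow> (\<forall>m n. m \<noteq> n \<longrightarrow> inf \<bar>x m\<bar> \<bar>x n\<bar> = 0)"

definition Lwc_set :: "'b::banach_lattice set \<Rightarrow> bool" where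
  "Lwc_set A \<longleftrightarrow>
     (\<forall>x. disjoint_sequence x \<and> range x \<subseteq> solid_hull A \<longrightarrow> x \<longlonglongrightarrow> 0)"

definition weakly_null :: "(nat \<Rightarrow> 'a::real_normed_vector) \<Rightarrow> bool" where
  "weakly_null x \<longleftrightarrow> (\<forall>\<phi> :: 'a \<Rightarrow>\<^sub>L real. (\<lambda>n. blinfun_apply \<phi> (x n)) \<longlonglongrightarrow> 0)"

(* The supremum is taken in ennreal so that it is 0 for the empty set;
   over real, the supremum of the empty set is unspecified. *)
definition Dunford_Pettis_set :: "'a::banach set \<Rightarrow> bool" where
  "Dunford_Pettis_set A \<longleftrightarrow>
     bounded A \<and>
     (\<forall>f :: nat \<Rightarrow> ('a \<Rightarrow>\<^sub>L real). weakly_null f \<longrightarrow>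
        (\<lambda>n. SUP a\<in>A. ennreal \<bar>blinfun_apply (f n) a\<bar>) \<longlonglongrightarrow> 0)"

definition DP_Lwc :: "('a::banach \<Rightarrow>\<^sub>L 'b::banach_lattice) \<Rightarrow> bool" where
  "DP_Lwc T \<longleftrightarrow> (\<forall>A. Dunford_Pettis_set A \<longrightarrow> Lwc_set (blinfun_apply T ` A))"

end

theory Submission
  imports Defs
begin

text \<open>If \<open>\<bar>x\<bar> \<le> \<bar>T a\<bar>\<close>, then \<open>y = inf \<bar>x\<bar> \<bar>T\<^sub>n a\<bar>\<close> satisfies
  \<open>0 \<le> \<bar>x\<bar> - y \<le> \<bar>(T - T\<^sub>n) a\<bar>\<close>. Thus a disjoint sequence in the solid hull of \<open>T A\<close> is uniformly
  approximated by a disjoint sequence in the solid hull of \<open>T\<^sub>n A\<close>, which is norm null.\<close>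

lemma norm_abs_banach_lattice: "norm \<bar>x\<bar> = norm (x::'b::banach_lattice)"
  by (intro antisym lattice_norm_mono) simp_all

lemma mem_solid_hull_iff: "x \<in> solid_hull A \<longleftrightarrow> (\<exists>a\<in>A. \<bar>x\<bar> \<le> \<bar>a\<bar>)"
  by (auto simp: solid_hull_def abs_le_iff minus_le_iff)

text \<open>\<open>\<bar>x\<bar> - \<bar>v\<bar>\<close> lies below both
  \<open>\<bar>x\<bar>\<close> and \<open>\<bar>u\<bar>\<close>, hence below their infimum. The part
  of \<open>\<bar>x\<bar>\<close> cut off by that infimum is therefore positive and at most
  \<open>\<bar>v\<bar>\<close>, and the lattice norm is monotone.\<close>

lemma norm_le_norm_inf_abs_add:
  fixes x :: "'b::banach_lattice"
  assumes "\<bar>x\<bar> \<le> \<bar>u\<bar> + \<bar>v\<bar>"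
  shows "norm x \<le> norm (inf \<bar>x\<bar> \<bar>u\<bar>) + norm v"
proof -
  let ?y = "inf \<bar>x\<bar> \<bar>u\<bar>"
  have "\<bar>x\<bar> - \<bar>v\<bar> \<le> ?y"
    using assms by (simp add: diff_le_eq)
  then have "\<bar>x\<bar> - ?y \<le> \<bar>v\<bar>"
    by (simp only: diff_le_eq add.commute)
  moreover have "0 \<le> \<bar>x\<bar> - ?y"
    by (simp only: diff_ge_0_iff_ge inf_le1)
  ultimately have "\<bar>\<bar>x\<bar> - ?y\<bar> \<le> \<bar>v\<bar>"
    by (simp only: abs_of_nonneg)
  then have "norm (\<bar>x\<bar> - ?y) \<le> norm v"
    by (rule lattice_norm_mono)
  moreover have "norm \<bar>x\<bar> \<le> norm ?y + norm (\<bar>x\<bar> - ?y)"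
    by (rule norm_triangle_sub)
  ultimately show ?thesis
    by (simp add: norm_abs_banach_lattice)
qed

lemma disjoint_sequence_mono:
  assumes x: "disjoint_sequence x" and le: "\<And>k. \<bar>y k\<bar> \<le> \<bar>x k\<bar>"
  shows "disjoint_sequence y"
  unfolding disjoint_sequence_def
proof (intro allI impI antisym)
  fix m n :: nat
  assume "m \<noteq> n"
  then have "inf \<bar>x m\<bar> \<bar>x n\<bar> = 0"
    using x by (simp add: disjoint_sequence_def)
  moreover have "inf \<bar>y m\<bar> \<bar>y n\<bar> \<le> inf \<bar>x m\<bar> \<bar>x n\<bar>"
    by (intro inf_mono le)
  ultimately show "inf \<bar>y m\<bar> \<bar>y n\<bar> \<le> 0"
    by simp
qed simp

text \<open>Isolates the lattice argument from the operators. For each tolerance one set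
  \<open>C\<close> serves all terms of a disjoint sequence, so truncating by elements of
  \<open>C\<close> gives a norm null sequence with uniformly small error.\<close>

lemma Lwc_set_approximation:
  fixes B :: "'b::banach_lattice set"
  assumes approx: "\<And>e. 0 < e \<Longrightarrow> \<exists>C. Lwc_set C \<and> (\<forall>b\<in>B. \<exists>c\<in>C. norm (b - c) < e)"
  shows "Lwc_set B"
  unfolding Lwc_set_def
proof (intro allI impI LIMSEQ_I, elim conjE)
  fix x :: "nat \<Rightarrow> 'b" and r :: real
  assume x: "disjoint_sequence x" "range x \<subseteq> solid_hull B" and "0 < r"
  \<comment> \<open>One half of \<open>r\<close> is for the truncated sequence, the other for the
    distance from \<open>B\<close> to \<open>C\<close>.\<close>
  then obtain C where C: "Lwc_set C" "\<And>b. b \<in> B \<Longrightarrow> \<exists>c\<in>C. norm (b - c) < r / 2"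
    using approx[of "r / 2"] by auto
  have "\<exists>b\<in>B. \<bar>x k\<bar> \<le> \<bar>b\<bar>" for k
    using x(2) by (simp add: image_subset_iff mem_solid_hull_iff)
  then obtain b where b: "\<And>k. b k \<in> B" "\<And>k. \<bar>x k\<bar> \<le> \<bar>b k\<bar>"
    by metis
  obtain c where c: "\<And>k. c k \<in> C" "\<And>k. norm (b k - c k) < r / 2"
    using C(2)[OF b(1)] by metis
  \<comment> \<open>Being below \<open>\<bar>x k\<bar>\<close> keeps \<open>y\<close> disjoint;
    being below \<open>\<bar>c k\<bar>\<close> puts it into \<open>solid_hull C\<close>.\<close>
  define y where "y k = inf \<bar>x k\<bar> \<bar>c k\<bar>" for k
  have y_nonneg: "\<bar>y k\<bar> = y k" for k
    by (simp add: y_def)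
  have "disjoint_sequence y"
    using x(1) by (rule disjoint_sequence_mono) (simp add: y_nonneg, simp add: y_def)
  moreover have "y k \<in> solid_hull C" for k
    unfolding mem_solid_hull_iff y_nonneg unfolding y_def using c(1) inf_le2 by (rule bexI[rotated])
  ultimately have "y \<longlonglongrightarrow> 0"
    using C(1) by (auto simp: Lwc_set_def)
  then obtain N where N: "\<And>k. N \<le> k \<Longrightarrow> norm (y k) < r / 2"
    using LIMSEQ_D[of y 0 "r / 2"] \<open>0 < r\<close> by auto
  have "norm (x k - 0) < r" if "N \<le> k" for k
  proof -
    have "\<bar>b k\<bar> \<le> \<bar>c k\<bar> + \<bar>b k - c k\<bar>"
      using abs_triangle_ineq[of "c k" "b k - c k"] by simp
    then have "norm (x k) \<le> norm (y k) + norm (b k - c k)"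
      unfolding y_def by (intro norm_le_norm_inf_abs_add order_trans[OF b(2)])
    then show ?thesis
      using N[OF that] c(2)[of k] by simp
  qed
  then show "\<exists>N. \<forall>k\<ge>N. norm (x k - 0) < r"
    by blast
qed

theorem proposition2p16:
  fixes T :: "'a::banach \<Rightarrow>\<^sub>L 'b::banach_lattice"
    and Tn :: "nat \<Rightarrow> ('a \<Rightarrow>\<^sub>L 'b)"
  assumes "\<And>n. DP_Lwc (Tn n)"
    and "Tn \<longlonglongrightarrow> T"
  shows "DP_Lwc T"
  unfolding DP_Lwc_def
proof (intro allI impI)
  fix A :: "'a set"
  assume A: "Dunford_Pettis_set A"
  \<comment> \<open>Boundedness of \<open>A\<close> turns convergence in operator norm into uniform
    convergence on \<open>A\<close>; \<open>M\<close> is taken positive so that \<open>e / M\<close>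
    is a valid tolerance.\<close>
  then obtain M where M: "0 < M" "\<And>a. a \<in> A \<Longrightarrow> norm a \<le> M"
    by (auto simp: Dunford_Pettis_set_def bounded_pos)
  show "Lwc_set (blinfun_apply T ` A)"
  proof (rule Lwc_set_approximation)
    fix e :: real
    assume "0 < e"
    then obtain n where n: "norm (Tn n - T) < e / M"
      using LIMSEQ_D[OF assms(2), of "e / M"] M(1) by auto
    have "norm (T a - Tn n a) < e" if "a \<in> A" for a
    proof -
      have "norm (T a - Tn n a) \<le> norm (T - Tn n) * norm a"
        using norm_blinfun[of "T - Tn n" a] by (simp add: blinfun.diff_left)
      also have "\<dots> \<le> norm (T - Tn n) * M"
        using M(2)[OF that] by (simp add: mult_left_mono)
      also have "\<dots> < e"
        using n M(1) by (simp add: norm_minus_commute pos_less_divide_eq)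
      finally show ?thesis .
    qed
    \<comment> \<open>The image of the same \<open>A\<close> under the single operator
      \<open>Tn n\<close> serves as the approximating set.\<close>
    moreover have "Lwc_set (Tn n ` A)"
      using assms(1) A by (simp add: DP_Lwc_def)
    ultimately show "\<exists>C. Lwc_set C \<and> (\<forall>b\<in>T ` A. \<exists>c\<in>C. norm (b - c) < e)"
      by (intro exI[of _ "Tn n ` A"]) auto
  qed
qed

end
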